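(* Let $m\ge 2$ be an integer and let $x\in(0,1)$. Then for every open interval $(a,b)$ with $\Lambda(x)\cap(a,b)\neq\emptyset$ we have $$\dim_H\big(\Lambda(x)\cap(a,b)\big)=\sup_{\lambda\in\Lambda(x)\cap(a,b)}\dim_H K_\lambda.$$
   Context: For $\lambda\in(0,1/m]$, $K_\lambda=\left\{\sum_{i=1}^\infty d_i\lambda^i: d_i\in\{0,1,\ldots,m-1\},\ i\ge 1\right\}\subset\mathbb R$, and for $x\in(0,1)$, $\Lambda(x)=\{\lambda\in(0,1/m]: x\in K_\lambda\}$. $\dim_H$ denotes Hausdorff dimension. *)

theory Defs
  imports "HOL-Analysis.Analysis"
begin

(* diam(U)^s with the usual conventions for s = 0: the empty set has weight 0 and every
   nonempty set has weight 1.  The case distinction is needed since 0 powr 0 = 0 in HOL. *)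
definition diam_weight :: "real \<Rightarrow> 'a::metric_space set \<Rightarrow> ennreal" where
  "diam_weight s U =
    (if U = {} then 0 else if s = 0 then 1 else ennreal (diameter U powr s))"

(* Boundedness is required explicitly because the library's diameter is an unspecified real
   on unbounded sets. *)
definition delta_covers :: "real \<Rightarrow> 'a::metric_space set \<Rightarrow> (nat \<Rightarrow> 'a set) set" where
  "delta_covers \<delta> S =
    {U. S \<subseteq> (\<Union>i. U i) \<and> (\<forall>i. bounded (U i) \<and> diameter (U i) \<le> \<delta>)}"

definition hausdorff_premeasure :: "real \<Rightarrow> real \<Rightarrow> 'a::metric_space set \<Rightarrow> ennreal" where
  "hausdorff_premeasure s \<delta> S = (INF U\<in>delta_covers \<delta> S. \<Sum>i. diam_weight s (U i))"

definition hausdorff_measure :: "real \<Rightarrow> 'a::metric_space set \<Rightarrow> ennreal" where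
  "hausdorff_measure s S = (SUP \<delta>\<in>{0<..}. hausdorff_premeasure s \<delta> S)"

definition hausdorff_dim :: "'a::metric_space set \<Rightarrow> ennreal" where
  "hausdorff_dim S = Inf {ennreal s | s. 0 \<le> s \<and> hausdorff_measure s S = 0}"

(* The series over i >= 1 is reindexed by Suc; the value d 0 is irrelevant. *)
definition K_set :: "nat \<Rightarrow> real \<Rightarrow> real set" where
  "K_set m l =
    {(\<Sum>i. real (d (Suc i)) * l ^ Suc i) | d :: nat \<Rightarrow> nat. \<forall>i\<ge>1. d i \<in> {0..m - 1}}"

definition Lambda_set :: "nat \<Rightarrow> real \<Rightarrow> real set" where
  "Lambda_set m x = {l. l \<in> {0<..1 / real m} \<and> x \<in> K_set m l}"

end

theory Submission
  imports Defs
begin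

text \<open>Write $v_e(\lambda) = \sum_i e_i \lambda^{i+1}$ for a sequence $e$ of digits below $m$, so that
  $\lambda \in \Lambda(x)$ means $v_e(\lambda) = x$ for some $e$.  Both sides of the claimed
  identity are compared with the similarity dimension $s(\lambda) = \log m / \log (1/\lambda)$,
  which is continuous in $\lambda$.

  Everything is read off from codings by digit sequences.  If points whose codes agree in their
  first $n$ digits are $O(r^n)$ apart, then the $m^n$ cylinders of level $n$ form a cover that
  gives dimension at most $s(r)$ (\<open>hausdorff_dim_le_of_contracting_coding\<close>).  If points whose
  codes first differ at place $k$ are at least $c r^k$ apart, then reading the code in base $m$
  is an $s(r)$-Hoelder map onto $[0,1]$, and the dimension is at least $s(r)$
  (\<open>hausdorff_dim_ge_of_separated_coding\<close>).  The two criteria give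
  $\dim K_\lambda = s(\lambda)$ for $\lambda < 1/m$, and $K_{1/m} = [0,1]$ has dimension $s(1/m) = 1$.

  For the upper bound, a point $\lambda$ of $\Lambda(x)$ is coded by a sequence $e$ with
  $v_e(\lambda) = x$.  If two parameters at most $r$ have codes that agree in $n$ digits, the common
  initial segment, a polynomial in $\lambda$, changes by at most $r^n$ between them, while it
  increases at a rate bounded below by a multiple of $x$.  So the dimension of a subset of
  $\Lambda(x)$ is at most $s(r)$ for $r$ its supremum, and $s(r)$ is a limit of values
  $s(\lambda) = \dim K_\lambda$ with $\lambda$ in that subset.

  For the lower bound near $\lambda_0 \in \Lambda(x)$, take $p < \lambda_0$ and a sequence $d$ with
  $v_d(p) < x < v_d(q)$ for some $q < 1/m$.  A long enough prefix $w$ of $d$ preserves the two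
  inequalities whatever digits $e$ follow it, so each $v_{we}$ takes the value $x$ at some
  $\lambda_e \in [p,q]$.  Because $q < 1/m$, changing $e$ first at place $k$ changes $v_{we}$ by at
  least a multiple of $p^k$; since all $v_{we}$ share a Lipschitz constant, the roots $\lambda_e$ are
  then separated by a multiple of $p^k$ as well.  This gives dimension at least $s(p)$, and $p$
  tends to $\lambda_0$.\<close>

section \<open>Values of digit sequences\<close>

definition digit_seqs :: "nat \<Rightarrow> (nat \<Rightarrow> nat) set" where
  "digit_seqs m = {e. \<forall>i. e i < m}"

definition digit_value :: "(nat \<Rightarrow> nat) \<Rightarrow> real \<Rightarrow> real" where
  "digit_value e l = (\<Sum>i. real (e i) * l ^ Suc i)"

lemma K_set_eq_image:
  assumes "m \<ge> 1"
  shows "K_set m l = (\<lambda>e. digit_value e l) ` digit_seqs m"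
proof (intro equalityI subsetI)
  fix y assume "y \<in> K_set m l"
  then obtain d where d: "y = (\<Sum>i. real (d (Suc i)) * l ^ Suc i)" "\<forall>i\<ge>1. d i \<in> {0..m - 1}"
    unfolding K_set_def by blast
  have "d (Suc i) < m" for i
    using d(2)[rule_format, of "Suc i"] assms by simp
  then have "(\<lambda>i. d (Suc i)) \<in> digit_seqs m"
    by (simp add: digit_seqs_def)
  moreover have "y = digit_value (\<lambda>i. d (Suc i)) l"
    by (simp add: d(1) digit_value_def)
  ultimately show "y \<in> (\<lambda>e. digit_value e l) ` digit_seqs m" by blast
next
  fix y assume "y \<in> (\<lambda>e. digit_value e l) ` digit_seqs m"
  then obtain e where e: "y = digit_value e l" "\<And>i. e i < m"
    by (auto simp: digit_seqs_def)
  have "e i \<le> m - 1" for i using e(2)[of i] by linarith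
  then show "y \<in> K_set m l"
    unfolding K_set_def
    by (intro CollectI exI[of _ "\<lambda>i. e (i - 1)"]) (simp add: e(1) digit_value_def)
qed

lemma digit_value_summable:
  assumes "e \<in> digit_seqs m" "0 \<le> l" "l < 1"
  shows "summable (\<lambda>i. real (e i) * l ^ Suc i)"
proof (rule summable_comparison_test')
  show "summable (\<lambda>i. real m * l * l ^ i)"
    using assms by (intro summable_mult summable_geometric) simp
  fix i
  have "real (e i) \<le> real m" using assms(1) by (auto simp: digit_seqs_def less_imp_le)
  then have "real (e i) * (l * l ^ i) \<le> real m * (l * l ^ i)"
    using assms by (intro mult_right_mono) auto
  then show "norm (real (e i) * l ^ Suc i) \<le> real m * l * l ^ i"
    using assms by (simp add: abs_mult mult_ac)
qed

lemma base_inverse_less_1: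
  assumes "m \<ge> 2" "l \<le> 1 / real m" shows "l < 1"
proof -
  have "1 / real m < 1" using assms(1) by simp
  then show ?thesis using assms(2) by linarith
qed

text \<open>The tail is at most $(m-1) l^{n+1}/(1-l)$, and $m - 1 \<le> m (1 - l)$ because $m l \<le> 1$.  Keeping
  the factor $m l$ in the bound is what makes cylinders strictly separated for $l < 1/m$.\<close>

lemma digit_value_truncation:
  assumes "m \<ge> 2" "e \<in> digit_seqs m" "0 \<le> l" "l \<le> 1 / real m"
  shows "(\<Sum>i<n. real (e i) * l ^ Suc i) \<le> digit_value e l"
    and "digit_value e l \<le> (\<Sum>i<n. real (e i) * l ^ Suc i) + real m * l * l ^ n"
proof -
  have l1: "l < 1" using base_inverse_less_1 assms by blast
  note sm = digit_value_summable[OF assms(2,3) l1]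
  have split: "digit_value e l = (\<Sum>i. real (e (i + n)) * l ^ Suc (i + n)) + (\<Sum>i<n. real (e i) * l ^ Suc i)"
    unfolding digit_value_def using suminf_split_initial_segment[OF sm] by simp
  have sm2: "summable (\<lambda>i. real (e (i + n)) * l ^ Suc (i + n))"
    using summable_ignore_initial_segment[OF sm, of n] by simp
  have "0 \<le> (\<Sum>i. real (e (i + n)) * l ^ Suc (i + n))"
    using assms by (intro suminf_nonneg sm2) auto
  then show "(\<Sum>i<n. real (e i) * l ^ Suc i) \<le> digit_value e l" using split by simp
  have "(\<Sum>i. real (e (i + n)) * l ^ Suc (i + n)) \<le> (\<Sum>i. (real m - 1) * l ^ Suc n * l ^ i)"
  proof (rule suminf_le[OF _ sm2])
    show "summable (\<lambda>i. (real m - 1) * l ^ Suc n * l ^ i)"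
      using assms l1 by (intro summable_mult summable_geometric) simp
    fix i
    have "e (i + n) < m" using assms(2) by (auto simp: digit_seqs_def)
    then have "real (e (i + n)) \<le> real m - 1" by linarith
    then have "real (e (i + n)) * l ^ Suc (i + n) \<le> (real m - 1) * l ^ Suc (i + n)"
      using assms by (intro mult_right_mono) auto
    then show "real (e (i + n)) * l ^ Suc (i + n) \<le> (real m - 1) * l ^ Suc n * l ^ i"
      by (simp add: power_add mult_ac)
  qed
  also have "\<dots> = (real m - 1) * l ^ Suc n * (1 / (1 - l))"
    using assms l1 by (subst suminf_mult) (auto simp: suminf_geometric summable_geometric)
  also have "\<dots> \<le> real m * l * l ^ n"
  proof -
    have "real m - 1 \<le> real m * (1 - l)"
      using assms by (simp add: field_simps)
    then have "(real m - 1) / (1 - l) \<le> real m"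
      using l1 by (simp add: divide_le_eq)
    then have "(real m - 1) / (1 - l) * l ^ Suc n \<le> real m * l ^ Suc n"
      using assms by (intro mult_right_mono) auto
    then show ?thesis by (simp add: mult_ac)
  qed
  finally show "digit_value e l \<le> (\<Sum>i<n. real (e i) * l ^ Suc i) + real m * l * l ^ n"
    using split by simp
qed

lemma digit_value_truncation_coarse:
  assumes "m \<ge> 2" "e \<in> digit_seqs m" "0 \<le> l" "l \<le> 1 / real m"
  shows "digit_value e l \<le> (\<Sum>i<n. real (e i) * l ^ Suc i) + l ^ n"
proof -
  have "real m * l \<le> 1" using assms by (simp add: field_simps)
  then have "real m * l * l ^ n \<le> 1 * l ^ n" using assms by (intro mult_right_mono) auto
  then show ?thesis using digit_value_truncation(2)[OF assms, of n] by simp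
qed

lemma digit_value_agree:
  assumes "m \<ge> 2" "e \<in> digit_seqs m" "e' \<in> digit_seqs m" "0 \<le> l" "l \<le> 1 / real m"
    and "\<And>i. i < n \<Longrightarrow> e i = e' i"
  shows "\<bar>digit_value e l - digit_value e' l\<bar> \<le> l ^ n"
proof -
  have "(\<Sum>i<n. real (e i) * l ^ Suc i) = (\<Sum>i<n. real (e' i) * l ^ Suc i)"
    using assms(6) by simp
  then show ?thesis
    using digit_value_truncation(1)[OF assms(1,2,4,5), of n]
      digit_value_truncation_coarse[OF assms(1,2,4,5), of n]
      digit_value_truncation(1)[OF assms(1,3,4,5), of n]
      digit_value_truncation_coarse[OF assms(1,3,4,5), of n] by linarith
qed

text \<open>At the first differing place the larger digit gains $l^{k+1}$, of which the later digits can
  recover at most the fraction $m l$.\<close>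

lemma digit_value_separation:
  assumes "m \<ge> 2" "e \<in> digit_seqs m" "e' \<in> digit_seqs m" "0 \<le> l" "l \<le> 1 / real m"
    and agree: "\<And>i. i < k \<Longrightarrow> e i = e' i" and less: "e k < e' k"
  shows "l ^ Suc k * (1 - real m * l) \<le> digit_value e' l - digit_value e l"
proof -
  have "(\<Sum>i<k. real (e i) * l ^ Suc i) = (\<Sum>i<k. real (e' i) * l ^ Suc i)"
    using agree by simp
  moreover have "(real (e k) + 1) * l ^ Suc k \<le> real (e' k) * l ^ Suc k"
    using less assms(4) by (intro mult_right_mono) auto
  ultimately have "(\<Sum>i<Suc k. real (e i) * l ^ Suc i) + l ^ Suc k \<le> (\<Sum>i<Suc k. real (e' i) * l ^ Suc i)"
    by (simp add: distrib_right)
  then have "l ^ Suc k - real m * l * l ^ Suc k \<le> digit_value e' l - digit_value e l"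
    using digit_value_truncation(2)[OF assms(1,2,4,5), of "Suc k"]
      digit_value_truncation(1)[OF assms(1,3,4,5), of "Suc k"] by linarith
  then show ?thesis by (simp add: algebra_simps)
qed

text \<open>A power series with nonnegative coefficients and no constant term grows at least linearly.  This
  turns an equation $v_e(l) = x$ into strict inequalities on either side of $l$.\<close>

lemma digit_value_scaling:
  assumes "m \<ge> 2" "e \<in> digit_seqs m" "0 \<le> l" "l \<le> l'" "l' \<le> 1 / real m"
  shows "l' * digit_value e l \<le> l * digit_value e l'"
proof -
  have l1: "l < 1" "l' < 1" "0 \<le> l'"
    using base_inverse_less_1[OF assms(1), of l] base_inverse_less_1[OF assms(1), of l'] assms by auto
  note sm = digit_value_summable[OF assms(2,3) l1(1)] digit_value_summable[OF assms(2) l1(3,2)]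
  have "(\<Sum>i. l' * (real (e i) * l ^ Suc i)) \<le> (\<Sum>i. l * (real (e i) * l' ^ Suc i))"
  proof (rule suminf_le)
    fix i
    have "l ^ i \<le> l' ^ i" using assms by (intro power_mono) auto
    then have "(l * l' * real (e i)) * l ^ i \<le> (l * l' * real (e i)) * l' ^ i"
      using assms by (intro mult_left_mono) auto
    then show "l' * (real (e i) * l ^ Suc i) \<le> l * (real (e i) * l' ^ Suc i)"
      by (simp add: mult_ac)
  qed (use sm in \<open>auto intro: summable_mult\<close>)
  then show ?thesis
    unfolding digit_value_def using sm by (simp add: suminf_mult)
qed

lemma power_Suc_diff_le:
  fixes l l' q :: real
  assumes "0 \<le> l" "l \<le> l'" "l' \<le> q"
  shows "l' ^ Suc i - l ^ Suc i \<le> real (Suc i) * q ^ i * (l' - l)"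
proof (induction i)
  case (Suc i)
  have "l' ^ Suc (Suc i) - l ^ Suc (Suc i) = l' * (l' ^ Suc i - l ^ Suc i) + l ^ Suc i * (l' - l)"
    by (simp add: algebra_simps)
  also have "\<dots> \<le> q * (real (Suc i) * q ^ i * (l' - l)) + q ^ Suc i * (l' - l)"
  proof (intro add_mono mult_mono mult_right_mono)
    show "l ^ Suc i \<le> q ^ Suc i" using assms by (intro power_mono) auto
    show "0 \<le> l' ^ Suc i - l ^ Suc i"
      using power_mono[of l l' "Suc i"] assms by simp
  qed (use assms Suc in auto)
  also have "\<dots> = real (Suc (Suc i)) * q ^ Suc i * (l' - l)"
    by (simp add: algebra_simps)
  finally show ?case .
qed simp

text \<open>One constant serves for all digit sequences, since $\sum_i m (i+1) m^{-i}$ bounds every derivative.\<close>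

lemma digit_value_lipschitz:
  assumes "m \<ge> 2"
  obtains L where "L > 0"
    and "\<And>e l l'. \<lbrakk>e \<in> digit_seqs m; 0 \<le> l; l \<le> 1 / real m; 0 \<le> l'; l' \<le> 1 / real m\<rbrakk>
           \<Longrightarrow> \<bar>digit_value e l - digit_value e l'\<bar> \<le> L * \<bar>l - l'\<bar>"
proof -
  define q where "q = 1 / real m"
  have q: "0 < q" "q < 1" using assms by (auto simp: q_def)
  have smq: "summable (\<lambda>i. real m * (real (Suc i) * q ^ i))"
    using q geometric_deriv_sums[of q] by (intro summable_mult) (auto simp: sums_iff)
  define L where "L = (\<Sum>i. real m * (real (Suc i) * q ^ i))"
  have "0 < L"
    unfolding L_def using assms q by (intro suminf_pos[OF smq]) auto
  have le: "\<bar>digit_value e l' - digit_value e l\<bar> \<le> L * (l' - l)"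
    if e: "e \<in> digit_seqs m" and l: "0 \<le> l" "l \<le> l'" "l' \<le> q" for e l l'
  proof -
    have "l < 1" "0 \<le> l'" "l' < 1" using l q by auto
    then have sm: "summable (\<lambda>i. real (e i) * l ^ Suc i)" "summable (\<lambda>i. real (e i) * l' ^ Suc i)"
      using digit_value_summable[OF e] l by auto
    have smd: "summable (\<lambda>i. real (e i) * l' ^ Suc i - real (e i) * l ^ Suc i)"
      using sm by (intro summable_diff)
    have diff: "digit_value e l' - digit_value e l
        = (\<Sum>i. real (e i) * l' ^ Suc i - real (e i) * l ^ Suc i)"
      unfolding digit_value_def using suminf_diff[OF sm(2,1)] by simp
    have "0 \<le> (\<Sum>i. real (e i) * l' ^ Suc i - real (e i) * l ^ Suc i)"
    proof (rule suminf_nonneg[OF smd])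
      fix i
      have "l ^ Suc i \<le> l' ^ Suc i" using l by (intro power_mono) auto
      then show "0 \<le> real (e i) * l' ^ Suc i - real (e i) * l ^ Suc i"
        by (simp only: diff_ge_0_iff_ge) (intro mult_left_mono; simp)
    qed
    moreover have "(\<Sum>i. real (e i) * l' ^ Suc i - real (e i) * l ^ Suc i)
        \<le> (\<Sum>i. (real m * (real (Suc i) * q ^ i)) * (l' - l))"
    proof (rule suminf_le[OF _ smd summable_mult2[OF smq]])
      fix i
      have "real (e i) \<le> real m" using e by (auto simp: digit_seqs_def less_imp_le)
      then have "real (e i) * (l' ^ Suc i - l ^ Suc i)
          \<le> real m * (real (Suc i) * q ^ i * (l' - l))"
        using power_Suc_diff_le[OF l, of i] power_mono[of l l' "Suc i"] l
        by (intro mult_mono) auto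
      then show "real (e i) * l' ^ Suc i - real (e i) * l ^ Suc i
          \<le> (real m * (real (Suc i) * q ^ i)) * (l' - l)"
        by (simp add: right_diff_distrib mult_ac)
    qed
    moreover have "(\<Sum>i. (real m * (real (Suc i) * q ^ i)) * (l' - l)) = L * (l' - l)"
      unfolding L_def using suminf_mult2[OF smq] by simp
    ultimately show ?thesis using diff by linarith
  qed
  show ?thesis
  proof (rule that[OF \<open>0 < L\<close>])
    fix e l l'
    assume "e \<in> digit_seqs m" "0 \<le> l" "l \<le> 1 / real m" "0 \<le> l'" "l' \<le> 1 / real m"
    then show "\<bar>digit_value e l - digit_value e l'\<bar> \<le> L * \<bar>l - l'\<bar>"
      using le[of e l l'] le[of e l' l] unfolding q_def
      by (cases "l \<le> l'") (simp_all add: abs_minus_commute)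
  qed
qed

text \<open>The remainders $r_{i+1} = m r_i - e_i$ stay in $[0,1]$ under the greedy choice of digits.  Capping
  the digit at $m - 1$ treats the endpoint $1$ together with the rest of the interval.\<close>

lemma digit_expansion_exists:
  assumes m: "m \<ge> 2" and y: "0 \<le> y" "y \<le> 1"
  obtains e where "e \<in> digit_seqs m" "digit_value e (1 / real m) = y"
proof -
  define dig :: "real \<Rightarrow> nat" where "dig = (\<lambda>r. min (m - 1) (nat \<lfloor>real m * r\<rfloor>))"
  define r where "r = rec_nat y (\<lambda>_ r. real m * r - real (dig r))"
  define e where "e = (\<lambda>i. dig (r i))"
  have r_Suc: "r (Suc i) = real m * r i - real (e i)" and r_0: "r 0 = y" for i
    by (simp_all add: r_def e_def)
  have dig: "0 \<le> real m * t - real (dig t) \<and> real m * t - real (dig t) \<le> 1"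
    if "0 \<le> t" "t \<le> 1" for t
  proof -
    have 0: "0 \<le> real m * t" "real m * t \<le> real m" using that mult_left_le[of t "real m"] by auto
    have 1: "real (nat \<lfloor>real m * t\<rfloor>) \<le> real m * t" "real m * t \<le> real (nat \<lfloor>real m * t\<rfloor>) + 1"
      using 0 by linarith+
    show ?thesis
    proof (cases "nat \<lfloor>real m * t\<rfloor> \<le> m - 1")
      case True
      then have "dig t = nat \<lfloor>real m * t\<rfloor>" by (simp add: dig_def)
      then show ?thesis using 1 by linarith
    next
      case False
      then have "real (dig t) = real m - 1" "real m - 1 \<le> real (nat \<lfloor>real m * t\<rfloor>)"
        using m by (auto simp: dig_def of_nat_diff)
      then show ?thesis using 0 1 by linarith
    qed
  qed
  have r01: "0 \<le> r i \<and> r i \<le> 1" for i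
    by (induction i) (use y dig in \<open>auto simp: r_0 r_Suc e_def\<close>)
  have e: "e \<in> digit_seqs m" using m by (auto simp: digit_seqs_def e_def dig_def)
  have part: "(\<Sum>i<n. real (e i) * (1 / real m) ^ Suc i) = y - r n * (1 / real m) ^ n" for n
  proof (induction n)
    case (Suc n)
    have "r n * (1 / real m) ^ n - real (e n) * (1 / real m) ^ Suc n = r (Suc n) * (1 / real m) ^ Suc n"
      using m by (simp add: r_Suc field_simps)
    then show ?case using Suc by simp
  qed (simp add: r_0)
  have "(\<lambda>n. r n * (1 / real m) ^ n) \<longlonglongrightarrow> 0"
  proof (rule Lim_null_comparison)
    show "(\<lambda>n. (1 / real m) ^ n) \<longlonglongrightarrow> 0" using m by (intro LIMSEQ_realpow_zero) auto
    show "\<forall>\<^sub>F n in sequentially. norm (r n * (1 / real m) ^ n) \<le> (1 / real m) ^ n"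
      using r01 by (intro always_eventually allI) (simp add: abs_mult mult_left_le_one_le)
  qed
  then have "(\<lambda>n. y - r n * (1 / real m) ^ n) \<longlonglongrightarrow> y - 0" by (intro tendsto_intros)
  then have "(\<lambda>i. real (e i) * (1 / real m) ^ Suc i) sums y"
    unfolding sums_def part by simp
  then have "digit_value e (1 / real m) = y" by (simp add: digit_value_def sums_iff)
  with e show ?thesis by (rule that)
qed

section \<open>Dimension bounds from digit codings\<close>

text \<open>This replaces the mass distribution principle: $h$ carries a cover of $A$ to a cover of $[0,1]$
  by sets of diameter at most $C\,\mathrm{diam}(U_i)^s$, and Lebesgue measure makes these sum to at
  least $1$.  The subset $B$ lets a well-separated part of $A$ carry the whole estimate.\<close>

lemma hausdorff_dim_ge_of_holder_surjection:
  fixes h :: "'a::metric_space \<Rightarrow> real"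
  assumes "B \<subseteq> A" and surj: "{0..1} \<subseteq> h ` B" and "C > 0" "s > 0"
    and holder: "\<And>a b. \<lbrakk>a \<in> B; b \<in> B\<rbrakk> \<Longrightarrow> \<bar>h a - h b\<bar> \<le> C * dist a b powr s"
  shows "ennreal s \<le> hausdorff_dim A"
  unfolding hausdorff_dim_def
proof (rule Inf_greatest, safe)
  fix t :: real assume t: "0 \<le> t" "hausdorff_measure t A = 0"
  show "ennreal s \<le> ennreal t"
  proof (rule ccontr)
    assume "\<not> ennreal s \<le> ennreal t"
    then have ts: "t < s" using ennreal_leI not_le by blast
    have "hausdorff_premeasure t 1 A \<le> hausdorff_measure t A"
      unfolding hausdorff_measure_def by (rule SUP_upper) simp
    then have pre0: "hausdorff_premeasure t 1 A = 0" using t(2) by simp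
    have "ennreal (1 / C) \<le> hausdorff_premeasure t 1 A"
      unfolding hausdorff_premeasure_def
    proof (rule INF_greatest)
      fix U assume "U \<in> delta_covers 1 A"
      then have cov: "A \<subseteq> (\<Union>i. U i)" and bd: "\<And>i. bounded (U i)" and diam: "\<And>i. diameter (U i) \<le> 1"
        by (auto simp: delta_covers_def)
      define V where "V = (\<lambda>i. h ` (U i \<inter> B))"
      \<comment> \<open>The sets \<open>V i\<close> may fail to be measurable; the intervals that they span have the same diameter.\<close>
      define J where "J = (\<lambda>i. if V i = {} then {} else {Inf (V i)..Sup (V i)})"
      have osc: "\<bar>v - v'\<bar> \<le> C * diameter (U i) powr s" if "v \<in> V i" "v' \<in> V i" for i v v'
      proof -
        obtain p q where pq: "p \<in> U i \<inter> B" "q \<in> U i \<inter> B" "v = h p" "v' = h q"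
          using \<open>v \<in> V i\<close> \<open>v' \<in> V i\<close> by (auto simp: V_def)
        have "dist p q \<le> diameter (U i)" using pq bd diameter_bounded_bound by blast
        then have "dist p q powr s \<le> diameter (U i) powr s"
          using \<open>s > 0\<close> by (intro powr_mono2) auto
        then show ?thesis
          using holder[of p q] pq \<open>C > 0\<close> by (smt (verit) IntD2 mult_left_mono)
      qed
      have bddV: "bdd_above (V i) \<and> bdd_below (V i)" for i
      proof (cases "V i = {}")
        case False
        then obtain v where "v \<in> V i" by blast
        then have "w \<le> v + C * diameter (U i) powr s \<and> v - C * diameter (U i) powr s \<le> w" if "w \<in> V i" for w
          using osc[OF \<open>v \<in> V i\<close> that] by linarith
        then show ?thesis by (meson bdd_above.I bdd_below.I)
      qed auto
      have VJ: "V i \<subseteq> J i" for i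
        using bddV[of i] by (auto simp: J_def intro: cInf_lower cSup_upper)
      have meas: "emeasure lborel (J i) \<le> ennreal C * diam_weight t (U i)" for i
      proof (cases "V i = {}")
        case False
        then have "U i \<noteq> {}" by (auto simp: V_def)
        have d0: "0 \<le> diameter (U i)" using diameter_ge_0 bd by blast
        have "Sup (V i) \<le> Inf (V i) + C * diameter (U i) powr s"
        proof (rule cSup_least[OF False])
          fix v assume "v \<in> V i"
          have "v - C * diameter (U i) powr s \<le> Inf (V i)"
            using osc[OF \<open>v \<in> V i\<close>] by (intro cInf_greatest[OF False]) (smt (verit))
          then show "v \<le> Inf (V i) + C * diameter (U i) powr s" by linarith
        qed
        moreover have "Inf (V i) \<le> Sup (V i)"
          using False bddV cInf_le_cSup by blast
        ultimately have "emeasure lborel (J i) \<le> ennreal (C * diameter (U i) powr s)"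
          using False by (simp add: J_def ennreal_leI)
        also have "\<dots> = ennreal C * ennreal (diameter (U i) powr s)"
          using \<open>C > 0\<close> by (simp add: ennreal_mult)
        also have "\<dots> \<le> ennreal C * diam_weight t (U i)"
        proof (rule mult_left_mono)
          \<comment> \<open>A nonempty set has weight \<open>1\<close> for \<open>t = 0\<close>, where \<open>diameter (U i) powr t\<close> can be \<open>0\<close>.\<close>
          have "diameter (U i) powr s \<le> 1"
            using d0 diam[of i] \<open>s > 0\<close> by (simp add: powr_le1)
          moreover have "diameter (U i) powr s \<le> diameter (U i) powr t"
            using d0 diam[of i] ts by (intro powr_mono') auto
          ultimately show "ennreal (diameter (U i) powr s) \<le> diam_weight t (U i)"
            using \<open>U i \<noteq> {}\<close> by (auto simp: diam_weight_def ennreal_leI)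
        qed simp
        finally show ?thesis .
      qed (simp add: J_def)
      have "{0..1} \<subseteq> (\<Union>i. J i)"
      proof
        fix y :: real assume "y \<in> {0..1}"
        then obtain p where "p \<in> B" "y = h p" using surj by blast
        moreover then obtain i where "p \<in> U i" using \<open>B \<subseteq> A\<close> cov by blast
        ultimately have "y \<in> V i" by (auto simp: V_def)
        then show "y \<in> (\<Union>i. J i)" using VJ by blast
      qed
      moreover have Jsets: "range J \<subseteq> sets lborel" by (auto simp: J_def)
      ultimately have "emeasure lborel {0..1::real} \<le> emeasure lborel (\<Union>i. J i)"
        by (intro emeasure_mono) auto
      also have "\<dots> \<le> (\<Sum>i. emeasure lborel (J i))"
        by (rule emeasure_subadditive_countably[OF Jsets])
      also have "\<dots> \<le> (\<Sum>i. ennreal C * diam_weight t (U i))"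
        by (intro suminf_le meas) auto
      also have "\<dots> = ennreal C * (\<Sum>i. diam_weight t (U i))" by simp
      finally have "1 \<le> ennreal C * (\<Sum>i. diam_weight t (U i))" by simp
      then have "ennreal (1 / C) * 1 \<le> ennreal (1 / C) * (ennreal C * (\<Sum>i. diam_weight t (U i)))"
        by (rule mult_left_mono) simp
      also have "\<dots> = (\<Sum>i. diam_weight t (U i))"
        using \<open>C > 0\<close> by (simp flip: mult.assoc ennreal_mult')
      finally show "ennreal (1 / C) \<le> (\<Sum>i. diam_weight t (U i))" by simp
    qed
    then show False using pre0 \<open>C > 0\<close> by simp
  qed
qed

text \<open>The solution $s$ of $m r^s = 1$, the dimension predicted by $m$ similarities of ratio $r$.\<close>

definition similarity_dim :: "nat \<Rightarrow> real \<Rightarrow> real" where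
  "similarity_dim m r = log (1 / r) (real m)"

lemma similarity_dim_pos:
  assumes "m \<ge> 2" "0 < r" "r < 1"
  shows "similarity_dim m r > 0"
  using assms by (simp add: similarity_dim_def)

lemma powr_similarity_dim:
  assumes "m \<ge> 2" "0 < r" "r < 1"
  shows "r powr similarity_dim m r = 1 / real m"
proof -
  have "(1 / r) powr similarity_dim m r = real m"
    unfolding similarity_dim_def using assms by (intro powr_log_cancel) auto
  then show ?thesis using assms by (simp add: powr_divide field_simps)
qed

lemma isCont_similarity_dim:
  assumes "0 < r" "r < 1"
  shows "isCont (\<lambda>l. ennreal (similarity_dim m l)) r"
proof -
  have "ln (1 / r) \<noteq> 0" using assms by (simp add: ln_div)
  then have "isCont (\<lambda>l. ln (real m) / ln (1 / l)) r"
    using assms by (intro continuous_intros) auto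
  then show ?thesis
    unfolding similarity_dim_def log_def isCont_def by (rule tendsto_ennrealI)
qed

text \<open>Separation makes $\phi$ injective, so the base-$m$ value of the code is a function of the point.
  It is Hoelder because $m^{-k} = (r^k)^s$ for $s$ the similarity dimension.\<close>

lemma hausdorff_dim_ge_of_separated_coding:
  fixes \<phi> :: "(nat \<Rightarrow> nat) \<Rightarrow> 'a::metric_space"
  assumes m: "m \<ge> 2" and r: "0 < r" "r < 1" and c: "c > 0"
    and sub: "\<phi> ` digit_seqs m \<subseteq> A"
    and sep: "\<And>e e' k. \<lbrakk>e \<in> digit_seqs m; e' \<in> digit_seqs m; \<And>i. i < k \<Longrightarrow> e i = e' i; e k < e' k\<rbrakk>
        \<Longrightarrow> c * r ^ k \<le> dist (\<phi> e) (\<phi> e')"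
  shows "ennreal (similarity_dim m r) \<le> hausdorff_dim A"
proof -
  define s where "s = similarity_dim m r"
  have s: "s > 0" using similarity_dim_pos m r by (simp add: s_def)
  have first_diff: "\<exists>k. (\<forall>i<k. e i = e' i) \<and> c * r ^ k \<le> dist (\<phi> e) (\<phi> e')"
    if e: "e \<in> digit_seqs m" "e' \<in> digit_seqs m" "e \<noteq> e'" for e e'
  proof -
    define k where "k = (LEAST i. e i \<noteq> e' i)"
    have "\<exists>i. e i \<noteq> e' i" using \<open>e \<noteq> e'\<close> by auto
    from LeastI_ex[OF this] have k: "e k \<noteq> e' k" unfolding k_def .
    have agree: "\<forall>i<k. e i = e' i"
    proof (intro allI impI)
      fix i assume "i < k"
      from not_less_Least[OF this[unfolded k_def]] show "e i = e' i" by simp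
    qed
    have "c * r ^ k \<le> dist (\<phi> e) (\<phi> e')"
    proof (cases "e k < e' k")
      case True
      show ?thesis by (intro sep e) (use agree True in auto)
    next
      case False
      then have "e' k < e k" using k by simp
      then have "c * r ^ k \<le> dist (\<phi> e') (\<phi> e)" by (intro sep e) (use agree in auto)
      then show ?thesis by (simp add: dist_commute)
    qed
    then show ?thesis using agree by blast
  qed
  have inj: "inj_on \<phi> (digit_seqs m)"
  proof (rule inj_onI, rule ccontr)
    fix e e' assume *: "e \<in> digit_seqs m" "e' \<in> digit_seqs m" "\<phi> e = \<phi> e'" "e \<noteq> e'"
    then obtain k where "c * r ^ k \<le> dist (\<phi> e) (\<phi> e')" using first_diff by blast
    moreover have "c * r ^ k > 0" using c r by simp
    ultimately show False using * by simp
  qed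
  define h where "h = (\<lambda>a. digit_value (inv_into (digit_seqs m) \<phi> a) (1 / real m))"
  have h: "h (\<phi> e) = digit_value e (1 / real m)" if "e \<in> digit_seqs m" for e
    using inj that by (simp add: h_def)
  have "ennreal s \<le> hausdorff_dim A"
  proof (rule hausdorff_dim_ge_of_holder_surjection[OF sub _ _ s])
    show "{0..1} \<subseteq> h ` \<phi> ` digit_seqs m"
    proof
      fix y :: real assume "y \<in> {0..1}"
      then obtain e where "e \<in> digit_seqs m" "digit_value e (1 / real m) = y"
        using digit_expansion_exists[OF m] by auto
      then show "y \<in> h ` \<phi> ` digit_seqs m" by (intro image_eqI[of _ _ "\<phi> e"]) (simp_all add: h)
    qed
    show "1 / c powr s > 0" using c by simp
    fix a b assume "a \<in> \<phi> ` digit_seqs m" "b \<in> \<phi> ` digit_seqs m"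
    then obtain e e' where e: "e \<in> digit_seqs m" "e' \<in> digit_seqs m" "a = \<phi> e" "b = \<phi> e'" by blast
    show "\<bar>h a - h b\<bar> \<le> 1 / c powr s * dist a b powr s"
    proof (cases "e = e'")
      case False
      then obtain k where k: "\<forall>i<k. e i = e' i" "c * r ^ k \<le> dist a b"
        using first_diff e by blast
      have "\<bar>h a - h b\<bar> \<le> (1 / real m) ^ k"
        using digit_value_agree[OF m e(1,2), of "1 / real m" k] k(1) e h by simp
      also have "\<dots> = (r powr s) ^ k"
        using powr_similarity_dim[OF m r] by (simp add: s_def)
      also have "\<dots> = (r ^ k) powr s"
        using r by (simp add: powr_powr mult_ac flip: powr_realpow)
      also have "\<dots> \<le> (dist a b / c) powr s"
        using k(2) c s r by (intro powr_mono2) (auto simp: field_simps)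
      also have "\<dots> = 1 / c powr s * dist a b powr s"
        using c by (simp add: powr_divide)
      finally show ?thesis .
    qed (simp add: e)
  qed
  then show ?thesis by (simp add: s_def)
qed

text \<open>For $t$ above the similarity dimension the $m^n$ cylinders of level $n$ have total weight at most
  $C^t (m r^t)^n$, which tends to $0$.  Only large $n$ matter, hence the threshold $N$.\<close>

lemma hausdorff_dim_le_of_contracting_coding:
  fixes A :: "'a::metric_space set"
  assumes m: "m \<ge> 2" and r: "0 < r" "r < 1" and C: "C > 0"
    and code: "\<And>a. a \<in> A \<Longrightarrow> code a \<in> digit_seqs m"
    and close: "\<And>a b n. \<lbrakk>N \<le> n; a \<in> A; b \<in> A; \<And>i. i < n \<Longrightarrow> code a i = code b i\<rbrakk>
        \<Longrightarrow> dist a b \<le> C * r ^ n"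
  shows "hausdorff_dim A \<le> ennreal (similarity_dim m r)"
proof (rule ennreal_le_epsilon)
  fix \<epsilon> :: real assume "0 < \<epsilon>"
  define s t where "s = similarity_dim m r" and "t = s + \<epsilon>"
  have s: "s > 0" using similarity_dim_pos m r by (simp add: s_def)
  then have t: "t > 0" using \<open>0 < \<epsilon>\<close> by (simp add: t_def)
  define q where "q = real m * r powr t"
  have "r powr t < r powr s" using r \<open>0 < \<epsilon>\<close> by (intro powr_less_mono') (auto simp: t_def)
  then have q: "0 < q" "q < 1"
    using powr_similarity_dim[OF m r] m r by (auto simp: q_def s_def field_simps)
  have pre: "hausdorff_premeasure t \<delta> A \<le> ennreal (C powr t * q ^ n)"
    if n: "N \<le> n" "C * r ^ n \<le> \<delta>" for n \<delta>
  proof -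
    define W where "W = PiE {..<n} (\<lambda>_. {..<m})"
    have "finite W" "card W = m ^ n" by (auto simp: W_def card_PiE intro: finite_PiE)
    then obtain g where g: "bij_betw g {0..<m ^ n} W"
      using ex_bij_betw_nat_finite by metis
    define U where "U = (\<lambda>i. if i < m ^ n then {a \<in> A. restrict (code a) {..<n} = g i} else {})"
    have dU: "dist a b \<le> C * r ^ n" if "a \<in> U i" "b \<in> U i" for a b i
    proof (rule close[OF n(1)])
      show "a \<in> A" "b \<in> A" using that by (auto simp: U_def split: if_splits)
      fix j assume "j < n"
      have "restrict (code a) {..<n} = restrict (code b) {..<n}"
        using that by (auto simp: U_def split: if_splits)
      then have "restrict (code a) {..<n} j = restrict (code b) {..<n} j" by simp
      then show "code a j = code b j" using \<open>j < n\<close> by simp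
    qed
    have bU: "bounded (U i)" for i
      unfolding bounded_two_points using dU by blast
    have diamU: "diameter (U i) \<le> C * r ^ n" for i
    proof (cases "U i = {}")
      case False
      then show ?thesis unfolding diameter_def using dU by (auto intro: cSUP_least)
    qed (use C r in simp)
    have "A \<subseteq> (\<Union>i. U i)"
    proof
      fix a assume "a \<in> A"
      then have "restrict (code a) {..<n} \<in> W"
        using code by (auto simp: W_def digit_seqs_def)
      then obtain i where "i < m ^ n" "g i = restrict (code a) {..<n}"
        using bij_betw_imp_surj_on[OF g] by (metis (no_types, lifting) atLeastLessThan_iff imageE)
      then show "a \<in> (\<Union>i. U i)" using \<open>a \<in> A\<close> by (auto simp: U_def intro!: exI[of _ i])
    qed
    then have "U \<in> delta_covers \<delta> A"
      using bU diamU n(2) by (auto simp: delta_covers_def intro: order_trans)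
    then have "hausdorff_premeasure t \<delta> A \<le> (\<Sum>i. diam_weight t (U i))"
      unfolding hausdorff_premeasure_def by (rule INF_lower)
    also have "\<dots> = (\<Sum>i<m ^ n. diam_weight t (U i))"
      by (rule suminf_finite) (auto simp: U_def diam_weight_def)
    also have "\<dots> \<le> (\<Sum>i<m ^ n. ennreal ((C * r ^ n) powr t))"
    proof (rule sum_mono)
      fix i
      have "diameter (U i) powr t \<le> (C * r ^ n) powr t"
        using diamU diameter_ge_0[OF bU] t by (intro powr_mono2) auto
      then show "diam_weight t (U i) \<le> ennreal ((C * r ^ n) powr t)"
        using t by (auto simp: diam_weight_def intro: ennreal_leI)
    qed
    also have "\<dots> = ennreal (real (m ^ n) * (C * r ^ n) powr t)"
      by (simp add: ennreal_mult ennreal_of_nat_eq_real_of_nat flip: ennreal_power)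
    also have "real (m ^ n) * (C * r ^ n) powr t = C powr t * q ^ n"
    proof -
      have "(r ^ n) powr t = (r powr t) ^ n"
        using r by (simp add: powr_powr mult_ac flip: powr_realpow)
      then show ?thesis using C r by (simp add: q_def powr_mult power_mult_distrib)
    qed
    finally show ?thesis .
  qed
  have "hausdorff_premeasure t \<delta> A \<le> 0" if "\<delta> > 0" for \<delta>
  proof (rule LIMSEQ_le_const)
    have "(\<lambda>n. C powr t * q ^ n) \<longlonglongrightarrow> C powr t * 0"
      using q by (intro tendsto_intros LIMSEQ_realpow_zero) auto
    then have "(\<lambda>n. ennreal (C powr t * q ^ n)) \<longlonglongrightarrow> ennreal 0"
      by (intro tendsto_ennrealI) simp
    then show "(\<lambda>n. ennreal (C powr t * q ^ n)) \<longlonglongrightarrow> 0" by simp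
    have "(\<lambda>n. C * r ^ n) \<longlonglongrightarrow> C * 0"
      using r by (intro tendsto_intros LIMSEQ_realpow_zero) auto
    then have "\<forall>\<^sub>F n in sequentially. C * r ^ n < \<delta>"
      using \<open>\<delta> > 0\<close> by (intro order_tendstoD) auto
    then obtain N' where "\<And>n. n \<ge> N' \<Longrightarrow> C * r ^ n < \<delta>"
      by (auto simp: eventually_sequentially)
    then show "\<exists>N. \<forall>n\<ge>N. hausdorff_premeasure t \<delta> A \<le> ennreal (C powr t * q ^ n)"
      using pre by (intro exI[of _ "max N N'"]) (auto simp: less_imp_le)
  qed
  then have "hausdorff_measure t A = 0"
    unfolding hausdorff_measure_def by (intro antisym SUP_least) auto
  then have "hausdorff_dim A \<le> ennreal t"
    unfolding hausdorff_dim_def using t by (intro Inf_lower) auto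
  then show "hausdorff_dim A \<le> ennreal (similarity_dim m r) + ennreal \<epsilon>"
    using s \<open>0 < \<epsilon>\<close> by (simp add: t_def s_def flip: ennreal_plus)
qed

section \<open>Dimension of the self-similar sets\<close>

text \<open>For $l = 1/m$ the cylinders touch, so the separation criterion fails; there $K_l$ contains $[0,1]$.\<close>

lemma hausdorff_dim_K_set:
  assumes m: "m \<ge> 2" and l: "0 < l" "l \<le> 1 / real m"
  shows "hausdorff_dim (K_set m l) = ennreal (similarity_dim m l)"
proof (rule antisym)
  have l1: "l < 1" using base_inverse_less_1 m l by blast
  have K: "K_set m l = (\<lambda>e. digit_value e l) ` digit_seqs m" using K_set_eq_image m by simp
  define code where "code = inv_into (digit_seqs m) (\<lambda>e. digit_value e l)"
  have code: "code a \<in> digit_seqs m" "digit_value (code a) l = a" if "a \<in> K_set m l" for a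
    using that inv_into_into[of a "\<lambda>e. digit_value e l" "digit_seqs m"]
      f_inv_into_f[of a "\<lambda>e. digit_value e l" "digit_seqs m"] by (simp_all add: K code_def)
  show "hausdorff_dim (K_set m l) \<le> ennreal (similarity_dim m l)"
  proof (rule hausdorff_dim_le_of_contracting_coding[OF m l(1) l1, of 1 _ code 0])
    fix a b n assume *: "a \<in> K_set m l" "b \<in> K_set m l" "\<And>i. i < n \<Longrightarrow> code a i = code b i"
    show "dist a b \<le> 1 * l ^ n"
      using digit_value_agree[OF m code(1)[OF *(1)] code(1)[OF *(2)] _ l(2) *(3)] l code(2) *
      by (simp add: dist_real_def)
  qed (use code in auto)
  show "ennreal (similarity_dim m l) \<le> hausdorff_dim (K_set m l)"
  proof (cases "l = 1 / real m")
    case True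
    have "{0..1} \<subseteq> K_set m l"
    proof
      fix y :: real assume "y \<in> {0..1}"
      then obtain e where "e \<in> digit_seqs m" "digit_value e (1 / real m) = y"
        using digit_expansion_exists[OF m, of y] by auto
      then show "y \<in> K_set m l" unfolding K by (intro image_eqI[of _ _ e]) (simp_all add: True)
    qed
    then have "ennreal 1 \<le> hausdorff_dim (K_set m l)"
      by (intro hausdorff_dim_ge_of_holder_surjection[of "K_set m l" _ id 1 1]) (auto simp: dist_real_def)
    then show ?thesis using True m by (simp add: similarity_dim_def)
  next
    case False
    then have ml: "real m * l < 1" using l m by (simp add: field_simps)
    show ?thesis
    proof (rule hausdorff_dim_ge_of_separated_coding[OF m l(1) l1, of "l * (1 - real m * l)" "\<lambda>e. digit_value e l"])
      fix e e' k
      assume "e \<in> digit_seqs m" "e' \<in> digit_seqs m" "\<And>i. i < k \<Longrightarrow> e i = e' i" "e k < e' k"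
      then have "l ^ Suc k * (1 - real m * l) \<le> digit_value e' l - digit_value e l"
        using digit_value_separation[OF m _ _ _ l(2)] l by simp
      then show "l * (1 - real m * l) * l ^ k \<le> dist (digit_value e l) (digit_value e' l)"
        by (simp add: dist_real_def mult_ac)
    qed (use l ml K in auto)
  qed
qed

section \<open>Upper bound for the parameter set\<close>

lemma Lambda_set_alt:
  assumes "m \<ge> 1"
  shows "l \<in> Lambda_set m x \<longleftrightarrow>
    0 < l \<and> l \<le> 1 / real m \<and> (\<exists>e\<in>digit_seqs m. digit_value e l = x)"
  using K_set_eq_image[OF assms, of l] by (auto simp: Lambda_set_def)

text \<open>The common initial segment $T$ has both values $T(l)$ and $T(l')$ within $r^n$ below $x$, so it
  grows by at most $r^n$ on $[l,l']$.  On the other hand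
  $l'^{i+1} - l^{i+1} \<ge> (l'-l)\,l'^i \<ge> (l'-l)\,l'^{i+1}$ gives $T(l') - T(l) \<ge> (l'-l)\,T(l')$,
  and $T(l') \<ge> x/2$.\<close>

lemma Lambda_set_close:
  assumes m: "m \<ge> 2" and e: "e \<in> digit_seqs m" "e' \<in> digit_seqs m"
    and l: "0 \<le> l" "l < l'" "l' \<le> r" "r \<le> 1 / real m"
    and x: "digit_value e l = x" "digit_value e' l' = x"
    and agree: "\<And>i. i < n \<Longrightarrow> e i = e' i" and n: "r ^ n \<le> x / 2"
  shows "(l' - l) * (x / 2) \<le> r ^ n"
proof -
  define T where "T = (\<lambda>l. \<Sum>i<n. real (e i) * l ^ Suc i)"
  have T': "T l' = (\<Sum>i<n. real (e' i) * l' ^ Suc i)" using agree by (simp add: T_def)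
  have pw: "l ^ n \<le> r ^ n" "l' ^ n \<le> r ^ n" using l by (auto intro: power_mono)
  have l'1: "l' \<le> 1" using base_inverse_less_1[OF m, of l'] l by linarith
  have up: "T l' \<le> x"
    using digit_value_truncation(1)[OF m e(2), of l' n] l x T' by simp
  have lo: "x \<le> T l + l ^ n"
    using digit_value_truncation_coarse[OF m e(1), of l n] l x by (simp add: T_def)
  have lo': "x \<le> T l' + l' ^ n"
    using digit_value_truncation_coarse[OF m e(2), of l' n] l x T' by simp
  have "(l' - l) * (x / 2) \<le> (l' - l) * T l'"
    using lo' pw n l by (intro mult_left_mono) auto
  also have "\<dots> = (\<Sum>i<n. real (e i) * ((l' - l) * (l' * l' ^ i)))"
    by (simp add: T_def sum_distrib_left mult_ac)
  also have "\<dots> \<le> (\<Sum>i<n. real (e i) * (l' ^ Suc i - l ^ Suc i))"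
  proof (intro sum_mono mult_left_mono)
    fix i
    have "(l' - l) * (l' * l' ^ i) \<le> (l' - l) * (1 * l' ^ i)"
      using l l'1 by (intro mult_left_mono mult_right_mono) auto
    moreover have "l * l ^ i \<le> l * l' ^ i"
      using l by (intro mult_left_mono power_mono) auto
    ultimately show "(l' - l) * (l' * l' ^ i) \<le> l' ^ Suc i - l ^ Suc i"
      by (simp add: algebra_simps)
  qed simp
  also have "\<dots> = T l' - T l"
    by (simp add: T_def right_diff_distrib sum_subtractf)
  also have "\<dots> \<le> r ^ n" using up lo pw by linarith
  finally show ?thesis .
qed

lemma hausdorff_dim_Lambda_set_le:
  assumes m: "m \<ge> 2" and x: "x > 0" and r: "0 < r" "r \<le> 1 / real m"
    and S: "S \<subseteq> Lambda_set m x" "\<And>l. l \<in> S \<Longrightarrow> l \<le> r"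
  shows "hausdorff_dim S \<le> ennreal (similarity_dim m r)"
proof -
  have r1: "r < 1" using base_inverse_less_1 m r by blast
  define code where "code = (\<lambda>l. SOME e. e \<in> digit_seqs m \<and> digit_value e l = x)"
  have code: "code l \<in> digit_seqs m \<and> digit_value (code l) l = x \<and> 0 < l" if "l \<in> S" for l
  proof -
    have "l \<in> Lambda_set m x" using that S(1) by blast
    then have "0 < l" "\<exists>e. e \<in> digit_seqs m \<and> digit_value e l = x"
      using m by (auto simp: Lambda_set_alt)
    then show ?thesis
      using someI_ex[of "\<lambda>e. e \<in> digit_seqs m \<and> digit_value e l = x"] by (simp add: code_def)
  qed
  have "(\<lambda>n. r ^ n) \<longlonglongrightarrow> 0" using r r1 by (intro LIMSEQ_realpow_zero) auto
  then have "\<forall>\<^sub>F n in sequentially. r ^ n < x / 2"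
    using x by (intro order_tendstoD) auto
  then obtain N where N: "\<And>n. n \<ge> N \<Longrightarrow> r ^ n < x / 2" by (auto simp: eventually_sequentially)
  show ?thesis
  proof (rule hausdorff_dim_le_of_contracting_coding[OF m r(1) r1, of "2 / x" _ code N])
    fix l l' n
    assume *: "N \<le> n" "l \<in> S" "l' \<in> S" "\<And>i. i < n \<Longrightarrow> code l i = code l' i"
    have **: "(q - p) * (x / 2) \<le> r ^ n"
      if "p \<in> S" "q \<in> S" "p < q" "\<And>i. i < n \<Longrightarrow> code p i = code q i" for p q
      using Lambda_set_close[OF m, of "code p" "code q" p q r x n] that code[of p] code[of q] r S(2) N[OF *(1)]
      by auto
    have "\<bar>l - l'\<bar> * (x / 2) \<le> r ^ n"
      using **[of l l'] **[of l' l] * r by (cases l l' rule: linorder_cases) auto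
    then show "dist l l' \<le> 2 / x * r ^ n"
      using x by (simp add: dist_real_def field_simps)
  qed (use x code in auto)
qed

section \<open>Lower bound for the parameter set\<close>

text \<open>If $l_0 < 1/m$, an expansion of $x$ in base $1/l_0$ works.  If $l_0 = 1/m$, there is no room to
  the right of $l_0$; instead, an expansion of a number $y$ slightly above $x$ has value $x$ already
  to the left of $1/m$.\<close>

lemma digit_value_straddle:
  assumes m: "m \<ge> 2" and x: "0 < x" "x < 1" and l0: "l0 \<in> Lambda_set m x"
    and lo: "0 < lo" "lo < l0" "l0 < b"
  obtains d hi where "d \<in> digit_seqs m" "lo < hi" "hi < 1 / real m" "hi < b"
    "digit_value d lo < x" "x < digit_value d hi"
proof -
  obtain d0 where d0: "d0 \<in> digit_seqs m" "digit_value d0 l0 = x" and l: "0 < l0" "l0 \<le> 1 / real m"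
    using l0 m by (auto simp: Lambda_set_alt)
  show ?thesis
  proof (cases "l0 < 1 / real m")
    case True
    define hi where "hi = (l0 + min b (1 / real m)) / 2"
    have hi: "l0 < hi" "hi < 1 / real m" "hi < b" using True lo by (auto simp: hi_def)
    have "l0 * digit_value d0 lo \<le> lo * x"
      using digit_value_scaling[OF m d0(1), of lo l0] lo l d0 by simp
    also have "\<dots> < l0 * x" using lo x by simp
    finally have 1: "digit_value d0 lo < x" using l by simp
    have "l0 * x < hi * x" using hi x by simp
    also have "\<dots> \<le> l0 * digit_value d0 hi"
      using digit_value_scaling[OF m d0(1), of l0 hi] l hi d0 by simp
    finally have 2: "x < digit_value d0 hi" using l by simp
    show ?thesis using that[OF d0(1) _ hi(2,3) 1 2] hi lo by simp
  next
    case False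
    define q where "q = 1 / real m"
    have q: "l0 = q" "lo < q" "0 < q" using False l lo by (auto simp: q_def)
    \<comment> \<open>By scaling, the value at \<open>lo\<close> is at most \<open>y * lo / q\<close>, which is below \<open>x\<close> iff \<open>y < z\<close>.\<close>
    define z where "z = q * x / lo"
    have "x < z" using q lo x by (simp add: z_def field_simps)
    define y where "y = min 1 ((x + z) / 2)"
    have y: "x < y" "y \<le> 1" "y < z" using x \<open>x < z\<close> by (simp_all add: y_def min_less_iff_disj)
    obtain d where d: "d \<in> digit_seqs m" "digit_value d q = y"
      unfolding q_def using digit_expansion_exists[OF m, of y] x y by auto
    have "q * digit_value d lo \<le> lo * y"
      using digit_value_scaling[OF m d(1), of lo q] lo q d by (simp add: q_def)
    also have "\<dots> < q * x" using y(3) lo by (simp add: z_def field_simps)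
    finally have 1: "digit_value d lo < x" using q by simp
    obtain L where L: "L > 0" and lip: "\<And>e l l'. \<lbrakk>e \<in> digit_seqs m; 0 \<le> l; l \<le> 1 / real m;
        0 \<le> l'; l' \<le> 1 / real m\<rbrakk> \<Longrightarrow> \<bar>digit_value e l - digit_value e l'\<bar> \<le> L * \<bar>l - l'\<bar>"
      using digit_value_lipschitz[OF m] by blast
    define \<eta> where "\<eta> = min ((q - lo) / 2) ((y - x) / (2 * L))"
    have "0 < (y - x) / (2 * L)" using y L by simp
    moreover have "\<eta> \<le> (q - lo) / 2" unfolding \<eta>_def by (rule min.cobounded1)
    ultimately have \<eta>: "0 < \<eta>" "\<eta> < q - lo" using q by (simp_all add: \<eta>_def)
    have "\<eta> * (2 * L) \<le> (y - x) / (2 * L) * (2 * L)"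
      using L by (intro mult_right_mono) (auto simp: \<eta>_def)
    then have L\<eta>: "L * \<eta> < y - x" using L y by (simp add: mult_ac)
    have "\<bar>digit_value d (q - \<eta>) - digit_value d q\<bar> \<le> L * \<bar>q - \<eta> - q\<bar>"
      using \<eta> q lo by (intro lip d) (auto simp: q_def)
    then have 2: "x < digit_value d (q - \<eta>)" using L\<eta> \<eta> d by simp
    show ?thesis
      using that[OF d(1) _ _ _ 1 2] \<eta> q lo by (simp add: q_def)
  qed
qed

text \<open>The roots of the series with a common long prefix of $d$ form a subset of $\Lambda(x) \cap (a,b)$
  that is coded by the free digits after the prefix and separated at scale \<open>lo ^ k\<close>.\<close>

lemma hausdorff_dim_Lambda_set_ge:
  assumes m: "m \<ge> 2" and x: "0 < x" "x < 1" and l0: "l0 \<in> Lambda_set m x" "l0 \<in> {a<..<b}"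
    and lo: "0 < lo" "a < lo" "lo < l0"
  shows "ennreal (similarity_dim m lo) \<le> hausdorff_dim (Lambda_set m x \<inter> {a<..<b})"
proof -
  obtain d hi where d: "d \<in> digit_seqs m" and hi: "lo < hi" "hi < 1 / real m" "hi < b"
    and straddle: "digit_value d lo < x" "x < digit_value d hi"
    using digit_value_straddle[OF m x l0(1) lo(1,3), of b] l0(2) by auto
  have hi1: "hi < 1" using base_inverse_less_1[OF m, of hi] hi by simp
  have "(\<lambda>n. hi ^ n) \<longlonglongrightarrow> 0" using lo hi hi1 by (intro LIMSEQ_realpow_zero) auto
  then have "\<forall>\<^sub>F n in sequentially. hi ^ n < min (x - digit_value d lo) (digit_value d hi - x)"
    using straddle by (intro order_tendstoD) auto
  then obtain n where "hi ^ n < min (x - digit_value d lo) (digit_value d hi - x)"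
    by (auto simp: eventually_sequentially)
  moreover have "lo ^ n \<le> hi ^ n" using lo hi by (intro power_mono) auto
  ultimately have n: "digit_value d lo + lo ^ n \<le> x" "x \<le> digit_value d hi - hi ^ n" by auto
  obtain L where L: "L > 0" and lip: "\<And>e l l'. \<lbrakk>e \<in> digit_seqs m; 0 \<le> l; l \<le> 1 / real m;
      0 \<le> l'; l' \<le> 1 / real m\<rbrakk> \<Longrightarrow> \<bar>digit_value e l - digit_value e l'\<bar> \<le> L * \<bar>l - l'\<bar>"
    using digit_value_lipschitz[OF m] by blast
  define ext where "ext = (\<lambda>e i. if i < n then d i else e (i - n) :: nat)"
  have ext: "ext e \<in> digit_seqs m" if "e \<in> digit_seqs m" for e
    using that d by (auto simp: ext_def digit_seqs_def)
  have ex: "\<exists>l. lo \<le> l \<and> l \<le> hi \<and> digit_value (ext e) l = x" if e: "e \<in> digit_seqs m" for e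
  proof (rule IVT')
    have "\<bar>digit_value (ext e) l - digit_value d l\<bar> \<le> l ^ n" if "l \<in> {lo..hi}" for l
      using that lo hi by (intro digit_value_agree[OF m ext[OF e] d]) (auto simp: ext_def)
    from this[of lo] this[of hi] show "digit_value (ext e) lo \<le> x" "x \<le> digit_value (ext e) hi"
      using n hi by auto
    show "lo \<le> hi" using hi by simp
    have "L-lipschitz_on {lo..hi} (digit_value (ext e))"
      using L lo hi by (intro lipschitz_onI) (auto simp: dist_real_def intro!: lip ext[OF e])
    then show "continuous_on {lo..hi} (digit_value (ext e))"
      by (rule lipschitz_on_continuous_on)
  qed
  define \<phi> where "\<phi> = (\<lambda>e. SOME l. lo \<le> l \<and> l \<le> hi \<and> digit_value (ext e) l = x)"
  have \<phi>: "lo \<le> \<phi> e \<and> \<phi> e \<le> hi \<and> digit_value (ext e) (\<phi> e) = x" if "e \<in> digit_seqs m" for e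
    unfolding \<phi>_def using ex[OF that] by (rule someI_ex)
  have mhi: "real m * hi < 1" using hi m by (simp add: field_simps)
  \<comment> \<open>The prefix of length \<open>n\<close> moves the first difference to place \<open>n + k\<close>, whose power is \<open>lo ^ Suc (n + k)\<close>.\<close>
  define c where "c = lo ^ Suc n * (1 - real m * hi) / L"
  show ?thesis
  proof (rule hausdorff_dim_ge_of_separated_coding[OF m lo(1)])
    show "lo < 1" using hi hi1 by simp
    show "0 < c" using lo mhi L by (simp add: c_def)
    show "\<phi> ` digit_seqs m \<subseteq> Lambda_set m x \<inter> {a<..<b}"
    proof safe
      fix e assume e: "e \<in> digit_seqs m"
      show "\<phi> e \<in> Lambda_set m x"
        using \<phi>[OF e] ext[OF e] lo hi m by (auto simp: Lambda_set_alt)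
      show "\<phi> e \<in> {a<..<b}" using \<phi>[OF e] lo hi by auto
    qed
    fix e e' k
    assume e: "e \<in> digit_seqs m" "e' \<in> digit_seqs m" and k: "\<And>i. i < k \<Longrightarrow> e i = e' i" "e k < e' k"
    define l l' where "l = \<phi> e" and "l' = \<phi> e'"
    have l: "lo \<le> l" "l \<le> hi" "digit_value (ext e) l = x"
      and l': "lo \<le> l'" "l' \<le> hi" "digit_value (ext e') l' = x"
      using \<phi> e by (auto simp: l_def l'_def)
    have "lo ^ Suc (n + k) * (1 - real m * hi) \<le> l ^ Suc (n + k) * (1 - real m * l)"
      using l lo mhi by (intro mult_mono power_mono) (auto intro: mult_left_mono)
    also have "\<dots> \<le> digit_value (ext e') l - digit_value (ext e) l"
      using l lo hi k by (intro digit_value_separation[OF m ext[OF e(1)] ext[OF e(2)]]) (auto simp: ext_def)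
    also have "\<dots> = digit_value (ext e') l - digit_value (ext e') l'" using l l' by simp
    also have "\<dots> \<le> L * dist l l'"
      using lip[OF ext[OF e(2)], of l l'] l l' lo hi by (auto simp: dist_real_def)
    finally have "lo ^ Suc (n + k) * (1 - real m * hi) / L \<le> dist l l'"
      using L by (simp add: field_simps)
    then show "c * lo ^ k \<le> dist (\<phi> e) (\<phi> e')"
      by (simp add: c_def l_def l'_def power_add mult_ac)
  qed
qed

section \<open>Local dimension of the parameter set\<close>

theorem corollary1p5:
  fixes m :: nat and x a b :: real
  assumes "m \<ge> 2"
    and "x \<in> {0<..<1}"
    and "Lambda_set m x \<inter> {a<..<b} \<noteq> {}"
  shows "hausdorff_dim (Lambda_set m x \<inter> {a<..<b})
           = (SUP l\<in>Lambda_set m x \<inter> {a<..<b}. hausdorff_dim (K_set m l))"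
proof (rule antisym)
  note m = assms(1)
  have x: "0 < x" "x < 1" using assms(2) by auto
  define S where "S = Lambda_set m x \<inter> {a<..<b}"
  have S0: "S \<noteq> {}" using assms(3) by (simp add: S_def)
  have S: "0 < l \<and> l \<le> 1 / real m \<and> l < 1" if "l \<in> S" for l
    using that m base_inverse_less_1[OF m, of l] by (auto simp: S_def Lambda_set_alt)
  have bdd: "bdd_above S" using S by (meson bdd_above.I)
  define r where "r = Sup S"
  have r: "0 < r" "r \<le> 1 / real m"
    unfolding r_def using S0 S cSup_upper[OF _ bdd] cSup_least[OF S0] by (metis ex_in_conv less_le_trans)+
  have r1: "r < 1" using base_inverse_less_1 m r by blast
  have "r \<in> closure S" unfolding r_def using S0 bdd by (rule closure_contains_Sup)
  then obtain u where u: "\<And>n. u n \<in> S" "u \<longlonglongrightarrow> r" by (auto simp: closure_sequential)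
  have "hausdorff_dim S \<le> ennreal (similarity_dim m r)"
    using hausdorff_dim_Lambda_set_le[OF m x(1) r, of S] cSup_upper[OF _ bdd] by (auto simp: S_def r_def)
  also have "\<dots> \<le> (SUP l\<in>S. hausdorff_dim (K_set m l))"
  proof (rule LIMSEQ_le_const2)
    show "(\<lambda>n. ennreal (similarity_dim m (u n))) \<longlonglongrightarrow> ennreal (similarity_dim m r)"
      using isCont_tendsto_compose[OF isCont_similarity_dim u(2)] r r1 by blast
    have "ennreal (similarity_dim m (u n)) \<le> (SUP l\<in>S. hausdorff_dim (K_set m l))" for n
      using hausdorff_dim_K_set[OF m, of "u n"] S[OF u(1)[of n]]
        SUP_upper[OF u(1)[of n], of "\<lambda>l. hausdorff_dim (K_set m l)"] by simp
    then show "\<exists>N. \<forall>n\<ge>N. ennreal (similarity_dim m (u n)) \<le> (SUP l\<in>S. hausdorff_dim (K_set m l))" by blast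
  qed
  finally show "hausdorff_dim (Lambda_set m x \<inter> {a<..<b})
      \<le> (SUP l\<in>Lambda_set m x \<inter> {a<..<b}. hausdorff_dim (K_set m l))"
    by (simp add: S_def)
  show "(SUP l\<in>Lambda_set m x \<inter> {a<..<b}. hausdorff_dim (K_set m l))
      \<le> hausdorff_dim (Lambda_set m x \<inter> {a<..<b})"
  proof (rule SUP_least)
    fix l0 assume l0: "l0 \<in> Lambda_set m x \<inter> {a<..<b}"
    then have l: "0 < l0" "l0 \<le> 1 / real m" "l0 < 1" using S by (auto simp: S_def)
    have "ennreal (similarity_dim m l0) \<le> hausdorff_dim (Lambda_set m x \<inter> {a<..<b})"
    proof (rule tendsto_upperbound)
      show "((\<lambda>l. ennreal (similarity_dim m l)) \<longlongrightarrow> ennreal (similarity_dim m l0)) (at_left l0)"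
        using isCont_similarity_dim[OF l(1,3)]
        unfolding isCont_def by (rule filterlim_mono[OF _ order_refl at_le]) simp
      have "max 0 a < l0" using l l0 by auto
      show "\<forall>\<^sub>F l in at_left l0. ennreal (similarity_dim m l) \<le> hausdorff_dim (Lambda_set m x \<inter> {a<..<b})"
        unfolding eventually_at_left[OF \<open>max 0 a < l0\<close>]
        using hausdorff_dim_Lambda_set_ge[OF m x, of l0 a b] l0 l(1)
        by (intro exI[of _ "max 0 a"]) auto
    qed (rule trivial_limit_at_left_real)
    then show "hausdorff_dim (K_set m l0) \<le> hausdorff_dim (Lambda_set m x \<inter> {a<..<b})"
      using hausdorff_dim_K_set[OF m l(1,2)] by simp
  qed
qed

end
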